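(* Let $f\in\mathcal{F}^1(\mathbb{R}^{d_1})\cap\mathcal{R}(\mathbb{R}^{d_1})$, $g\in\mathcal{F}^1(\mathbb{R}^{d_2})$, $F\in\mathbb{R}^{m\times d_1}$, $G\in\mathbb{R}^{m\times d_2}$, $h\in\mathbb{R}^m$ and $s>0$. Let $(x^\star,y^\star;\lambda^\star)$ be a saddle point of the Lagrangian $L(x,y;\lambda)=f(x)+g(y)+\langle\lambda,Fx+Gy-h\rangle$. Let $(X,Y;\Lambda)=(X(t),Y(t);\Lambda(t))$, $t\ge 0$, be a solution of the system $$F^{\top}G\dot{Y}=F^{\top}\Lambda+\nabla f(X),\qquad 0=G^{\top}\Lambda+\nabla g(Y),\qquad s^2\dot{\Lambda}=FX+GY-h.$$ Then the function $$\mathcal{E}(t)=\frac{1}{2s}\|G(Y(t)-y^\star)\|^2+\frac{s}{2}\|\Lambda(t)-\lambda^\star\|^2$$ is monotonically decreasing (i.e. nonincreasing) in $t$.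
   Context: $\|\cdot\|$ is the Euclidean norm and $\langle\cdot,\cdot\rangle$ the Euclidean inner product. $\mathcal{F}^1(\mathbb{R}^d)$ is the class of differentiable convex functions $\mathbb{R}^d\to\mathbb{R}$. $\mathcal{R}(\mathbb{R}^{d_1})$ is the class of functions $f$ for which the minimization problem $\min_{x\in\mathbb{R}^{d_1}}\{f(x)+\frac{1}{2s}\|Fx+c\|^2\}$ has a solution for every $c\in\mathbb{R}^m$. A saddle point $(x^\star,y^\star;\lambda^\star)\in\mathbb{R}^{d_1}\times\mathbb{R}^{d_2}\times\mathbb{R}^m$ of $L$ satisfies $L(x^\star,y^\star;\lambda)\le L(x^\star,y^\star;\lambda^\star)\le L(x,y;\lambda^\star)$ for all $x,y,\lambda$; in particular $Fx^\star+Gy^\star=h$. Solutions of the system are assumed smooth (continuously differentiable functions of $t\ge0$); dots denote $t$-derivatives. *)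

theory Defs
  imports "HOL-Analysis.Analysis"
begin

definition gradient :: "('a::real_inner \<Rightarrow> real) \<Rightarrow> 'a \<Rightarrow> 'a" where
  "gradient f x = (THE D. GDERIV f x :> D)"

lemma gradient_eq: "gradient f x = D" if "GDERIV f x :> D"
  unfolding gradient_def
proof (rule the_equality)
  show "GDERIV f x :> D" by fact
next
  fix E assume "GDERIV f x :> E"
  with that have "(\<lambda>h. h \<bullet> E) = (\<lambda>h. h \<bullet> D)"
    unfolding gderiv_def by (rule has_derivative_unique[rotated])
  then have "(E - D) \<bullet> (E - D) = 0"
    by (metis inner_diff_right right_minus_eq)
  then show "E = D" by simp
qed

lemma GDERIV_gradient:
  fixes f :: "'a::euclidean_space \<Rightarrow> real"
  assumes "f differentiable at x"
  shows "GDERIV f x :> gradient f x"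
proof -
  obtain f' where f': "(f has_derivative f') (at x)"
    using assms by (auto simp: differentiable_def)
  then interpret linear f' by (rule has_derivative_linear)
  have "f' = (\<lambda>h. h \<bullet> adjoint f' 1)"
    by (rule ext) (simp add: adjoint_works[OF linear_axioms])
  with f' have "GDERIV f x :> adjoint f' 1" by (simp add: gderiv_def)
  then show ?thesis by (simp add: gradient_eq)
qed

definition diff_convex :: "('a::real_normed_vector \<Rightarrow> real) set" where
  "diff_convex = {f. convex_on UNIV f \<and> f differentiable_on UNIV}"

definition prox_solvable :: "real^'n^'m \<Rightarrow> real \<Rightarrow> (real^'n \<Rightarrow> real) set" where
  "prox_solvable F s =
     {f. \<forall>c. \<exists>x. \<forall>z. f x + 1 / (2 * s) * (norm (F *v x + c))\<^sup>2
                     \<le> f z + 1 / (2 * s) * (norm (F *v z + c))\<^sup>2}"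

definition saddle_point :: "('a \<Rightarrow> 'b \<Rightarrow> 'c \<Rightarrow> real) \<Rightarrow> 'a \<Rightarrow> 'b \<Rightarrow> 'c \<Rightarrow> bool" where
  "saddle_point L x\<^sub>0 y\<^sub>0 l\<^sub>0 \<longleftrightarrow>
     (\<forall>x y l. L x\<^sub>0 y\<^sub>0 l \<le> L x\<^sub>0 y\<^sub>0 l\<^sub>0 \<and> L x\<^sub>0 y\<^sub>0 l\<^sub>0 \<le> L x y l\<^sub>0)"

definition lagrangian ::
  "(real^'n \<Rightarrow> real) \<Rightarrow> (real^'k \<Rightarrow> real) \<Rightarrow> real^'n^'m \<Rightarrow> real^'k^'m \<Rightarrow> real^'m
    \<Rightarrow> real^'n \<Rightarrow> real^'k \<Rightarrow> real^'m \<Rightarrow> real" where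
  "lagrangian f g F G h x y l = f x + g y + l \<bullet> (F *v x + G *v y - h)"

text \<open>The time derivative on the half-line; at time 0 it is the right derivative, so that
  nothing is assumed about curves at negative times.\<close>

definition time_deriv :: "(real \<Rightarrow> 'a::real_normed_vector) \<Rightarrow> real \<Rightarrow> 'a" where
  "time_deriv u t = vector_derivative u (at t within {0..})"

definition C1_curve :: "(real \<Rightarrow> 'a::real_normed_vector) \<Rightarrow> bool" where
  "C1_curve u \<longleftrightarrow> u differentiable_on {0..} \<and> continuous_on {0..} (time_deriv u)"

definition ode_solution ::
  "(real^'n \<Rightarrow> real) \<Rightarrow> (real^'k \<Rightarrow> real) \<Rightarrow> real^'n^'m \<Rightarrow> real^'k^'m \<Rightarrow> real^'m \<Rightarrow> real
    \<Rightarrow> (real \<Rightarrow> real^'n) \<Rightarrow> (real \<Rightarrow> real^'k) \<Rightarrow> (real \<Rightarrow> real^'m) \<Rightarrow> bool" where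
  "ode_solution f g F G h s X Y \<Lambda> \<longleftrightarrow>
     C1_curve X \<and> C1_curve Y \<and> C1_curve \<Lambda> \<and>
     (\<forall>t\<ge>0.
        (transpose F ** G) *v time_deriv Y t = transpose F *v \<Lambda> t + gradient f (X t) \<and>
        0 = transpose G *v \<Lambda> t + gradient g (Y t) \<and>
        s\<^sup>2 *\<^sub>R time_deriv \<Lambda> t = F *v X t + G *v Y t - h)"

end

theory Submission
  imports Defs
begin

text \<open>The energy \<open>E\<close> is continuous on the half-line and differentiable for \<open>t > 0\<close>, so it
  suffices that \<open>E'(t) \<le> 0\<close> there. A saddle point satisfies \<open>F x\<^sup>* + G y\<^sup>* = h\<close>, and hence
  \<open>s\<^sup>2 \<Lambda>' = F (X - x\<^sup>*) + G (Y - y\<^sup>*)\<close>. Differentiating, substituting this for \<open>\<Lambda>'\<close>, and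
  then eliminating \<open>F\<^sup>T\<Lambda>\<close> and \<open>G\<^sup>T\<Lambda>\<close> with the other two equations gives
  \<open>s E' = s\<^sup>2 \<langle>\<Lambda>', G Y'\<rangle> - \<langle>\<nabla>f(X) + F\<^sup>T\<lambda>\<^sup>*, X - x\<^sup>*\<rangle> - \<langle>\<nabla>g(Y) + G\<^sup>T\<lambda>\<^sup>*, Y - y\<^sup>*\<rangle>\<close>.

  The last two inner products are nonnegative because \<open>x\<^sup>*\<close> minimizes the convex function
  \<open>f + \<langle>F\<^sup>T\<lambda>\<^sup>*, \<cdot>\<rangle>\<close> and \<open>y\<^sup>*\<close> minimizes \<open>g + \<langle>G\<^sup>T\<lambda>\<^sup>*, \<cdot>\<rangle>\<close>
  (\<open>gradient_inner_nonneg_of_minimizer\<close>). The first term is nonpositive because the constraint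
  \<open>G\<^sup>T\<Lambda> = -\<nabla>g(Y)\<close> holds for all times: formally its derivative, paired with \<open>Y'\<close>, is
  \<open>-\<langle>\<nabla>\<^sup>2g(Y) Y', Y'\<rangle>\<close>. As \<open>g\<close> need not be twice differentiable, the same conclusion is drawn
  from difference quotients: \<open>\<langle>\<Lambda>(r) - \<Lambda>(t), G (Y(r) - Y(t))\<rangle> \<le> 0\<close> by monotonicity of
  \<open>\<nabla>g\<close>, and \<open>inner_derivatives_nonpos\<close> passes to the limit.\<close>

section \<open>Gradients of convex functions\<close>

text \<open>The one-dimensional tangent inequality, applied to the restriction of \<open>f\<close> to the line
  through \<open>x\<close> and \<open>z\<close>.\<close>

lemma convex_gradient_inequality:
  fixes f :: "'a::euclidean_space \<Rightarrow> real"
  assumes cvx: "convex_on UNIV f" and diff: "f differentiable at x"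
  shows "f x + (z - x) \<bullet> gradient f x \<le> f z"
proof -
  define p where "p u = f (x + u *\<^sub>R (z - x))" for u :: real
  have "convex_on UNIV p"
  proof (rule convex_onI)
    fix t a b :: real
    assume "0 < t" "t < 1"
    have "x + ((1 - t) *\<^sub>R a + t *\<^sub>R b) *\<^sub>R (z - x)
        = (1 - t) *\<^sub>R (x + a *\<^sub>R (z - x)) + t *\<^sub>R (x + b *\<^sub>R (z - x))"
      by (simp add: algebra_simps)
    then show "p ((1 - t) *\<^sub>R a + t *\<^sub>R b) \<le> (1 - t) * p a + t * p b"
      unfolding p_def using convex_onD[OF cvx, of t] \<open>0 < t\<close> \<open>t < 1\<close> by simp
  qed simp
  moreover have "(p has_field_derivative (z - x) \<bullet> gradient f x) (at 0)"
  proof -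
    have line: "((\<lambda>u. x + u *\<^sub>R (z - x)) has_derivative (\<lambda>u. u *\<^sub>R (z - x))) (at (0::real))"
      by (auto intro!: derivative_eq_intros)
    have "(f has_derivative (\<lambda>k. k \<bullet> gradient f x)) (at (x + 0 *\<^sub>R (z - x)))"
      using GDERIV_gradient[OF diff] by (simp add: gderiv_def)
    from has_derivative_compose[OF line this] show ?thesis
      unfolding p_def has_field_derivative_def by (simp add: mult.commute[of _ "_ \<bullet> _"] mult_commute_abs)
  qed
  ultimately have "(z - x) \<bullet> gradient f x * (1 - 0) \<le> p 1 - p 0"
    by (intro convex_on_imp_above_tangent[where A = UNIV]) auto
  then show ?thesis by (simp add: p_def)
qed

lemma convex_gradient_monotone:
  fixes f :: "'a::euclidean_space \<Rightarrow> real"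
  assumes "convex_on UNIV f" "f differentiable at x" "f differentiable at z"
  shows "(gradient f z - gradient f x) \<bullet> (z - x) \<ge> 0"
  using convex_gradient_inequality[OF assms(1,2), of z]
    convex_gradient_inequality[OF assms(1,3), of x]
  by (simp add: inner_commute algebra_simps)

text \<open>On the segment from \<open>x\<close> to \<open>x\<^sub>0\<close> the convex function \<open>f + \<langle>a, \<cdot>\<rangle>\<close> cannot have a positive
  initial slope, because its value at \<open>x\<^sub>0\<close> is not larger than at \<open>x\<close>.\<close>

lemma gradient_inner_nonneg_of_minimizer:
  fixes f :: "'a::euclidean_space \<Rightarrow> real"
  assumes "convex_on UNIV f" "f differentiable at x"
    and min: "f x\<^sub>0 + a \<bullet> x\<^sub>0 \<le> f x + a \<bullet> x"
  shows "(gradient f x + a) \<bullet> (x - x\<^sub>0) \<ge> 0"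
  using convex_gradient_inequality[OF assms(1,2), of x\<^sub>0] min
  by (simp add: inner_commute algebra_simps)

section \<open>Derivatives of curves\<close>

lemma has_vector_derivative_imp_slope_tendsto:
  assumes "(u has_vector_derivative u') (at t)"
  shows "((\<lambda>r. (u r - u t) /\<^sub>R (r - t)) \<longlongrightarrow> u') (at t)"
proof -
  have "((\<lambda>r. norm ((u r - u t) - (r - t) *\<^sub>R u') / norm (r - t)) \<longlongrightarrow> 0) (at t)"
    using assms by (simp add: has_vector_derivative_def has_derivative_iff_norm)
  also have "?this \<longleftrightarrow> ((\<lambda>r. norm ((u r - u t) /\<^sub>R (r - t) - u')) \<longlongrightarrow> 0) (at t)"
  proof (intro LIM_equal allI impI)
    fix r assume "r \<noteq> t"
    then have "(u r - u t) /\<^sub>R (r - t) - u' = ((u r - u t) - (r - t) *\<^sub>R u') /\<^sub>R (r - t)"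
      by (simp add: scaleR_diff_right)
    then show "norm ((u r - u t) - (r - t) *\<^sub>R u') / norm (r - t)
        = norm ((u r - u t) /\<^sub>R (r - t) - u')"
      by (simp add: divide_inverse_commute)
  qed
  finally show ?thesis
    by (rule tendsto_norm_zero_cancel[THEN LIM_zero_cancel])
qed

text \<open>The inner product of the velocities is the limit of the inner products of the increments
  divided by \<open>(r - t)\<^sup>2\<close>. This replaces a second derivative of \<open>g\<close> in the energy estimate.\<close>

lemma inner_derivatives_nonpos:
  fixes u v :: "real \<Rightarrow> 'a::real_inner"
  assumes u: "(u has_vector_derivative u') (at t)" and v: "(v has_vector_derivative v') (at t)"
    and ev: "\<forall>\<^sub>F r in at t. (u r - u t) \<bullet> (v r - v t) \<le> 0"
  shows "u' \<bullet> v' \<le> 0"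
proof (rule tendsto_upperbound)
  show "((\<lambda>r. ((u r - u t) /\<^sub>R (r - t)) \<bullet> ((v r - v t) /\<^sub>R (r - t))) \<longlongrightarrow> u' \<bullet> v') (at t)"
    by (intro tendsto_inner has_vector_derivative_imp_slope_tendsto u v)
  show "\<forall>\<^sub>F r in at t. ((u r - u t) /\<^sub>R (r - t)) \<bullet> ((v r - v t) /\<^sub>R (r - t)) \<le> 0"
    using ev
  proof eventually_elim
    case (elim r)
    have "0 \<le> inverse (r - t) * inverse (r - t)" by simp
    then have "(inverse (r - t) * inverse (r - t)) * ((u r - u t) \<bullet> (v r - v t)) \<le> 0"
      using elim by (rule mult_nonneg_nonpos)
    then show ?case by (simp add: mult.assoc)
  qed
qed simp

lemma has_real_derivative_norm_square:
  fixes u :: "real \<Rightarrow> 'a::real_inner"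
  assumes "(u has_vector_derivative u') (at t)"
  shows "((\<lambda>r. (norm (u r))\<^sup>2) has_real_derivative 2 * (u t \<bullet> u')) (at t)"
  using bounded_bilinear.has_vector_derivative[OF bounded_bilinear_inner assms assms]
  by (simp add: has_real_derivative_iff_has_vector_derivative power2_norm_eq_inner inner_commute)

lemma C1_curve_has_vector_derivative:
  assumes "C1_curve u" "t > 0"
  shows "(u has_vector_derivative time_deriv u t) (at t)"
proof -
  have "at t within {0..} = at t"
    using \<open>t > 0\<close> by (intro at_within_interior) simp
  moreover have "u differentiable at t within {0..}"
    using assms by (auto simp: C1_curve_def differentiable_on_def)
  ultimately show ?thesis
    unfolding time_deriv_def by (metis vector_derivative_works)
qed

lemma C1_curve_continuous_on: "C1_curve u \<Longrightarrow> continuous_on {0..} u"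
  by (simp add: C1_curve_def differentiable_imp_continuous_on)

text \<open>Continuity takes care of the boundary point \<open>0\<close>, where the curves have only one-sided
  derivatives.\<close>

lemma antimono_on_half_line:
  fixes \<phi> :: "real \<Rightarrow> real"
  assumes cont: "continuous_on {0..} \<phi>"
    and deriv: "\<And>t. t > 0 \<Longrightarrow> \<exists>D. DERIV \<phi> t :> D \<and> D \<le> 0"
  shows "antimono_on {0..} \<phi>"
proof (rule monotone_onI)
  fix a b :: real
  assume ab: "a \<in> {0..}" "b \<in> {0..}" "a \<le> b"
  show "\<phi> b \<le> \<phi> a"
  proof (rule DERIV_nonpos_imp_decreasing_open[where f = \<phi>])
    show "continuous_on {a..b} \<phi>"
      using cont by (rule continuous_on_subset) (use ab in auto)
  qed (use ab deriv in auto)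
qed

section \<open>Saddle points of the Lagrangian\<close>

lemma inner_transpose_mult:
  fixes A :: "real^'n^'m"
  shows "(transpose A *v l) \<bullet> x = l \<bullet> (A *v x)"
  by (metis dot_lmul_matrix transpose_matrix_vector)

text \<open>The Lagrangian is affine in the multiplier with slope \<open>F x + G y - h\<close>, so it is bounded
  above in that variable only where the slope vanishes; moving the multiplier by the slope itself
  shows this.\<close>

lemma saddle_point_feasible:
  assumes "saddle_point (lagrangian f g F G h) xs ys ls"
  shows "F *v xs + G *v ys = h"
proof -
  define w where "w = F *v xs + G *v ys - h"
  have "lagrangian f g F G h xs ys (ls + w) \<le> lagrangian f g F G h xs ys ls"
    using assms by (auto simp: saddle_point_def)
  then have "w \<bullet> w \<le> 0"
    unfolding lagrangian_def w_def[symmetric] by (simp add: inner_add_left)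
  then have "w = 0" by (metis inner_ge_zero inner_eq_zero_iff order_antisym)
  then show ?thesis by (simp add: w_def)
qed

lemma saddle_point_minimizer_fst:
  assumes "saddle_point (lagrangian f g F G h) xs ys ls"
  shows "f xs + (transpose F *v ls) \<bullet> xs \<le> f x + (transpose F *v ls) \<bullet> x"
proof -
  have "lagrangian f g F G h xs ys ls \<le> lagrangian f g F G h x ys ls"
    using assms by (auto simp: saddle_point_def)
  then show ?thesis
    by (simp add: lagrangian_def inner_transpose_mult inner_add_right inner_diff_right
        del: transpose_matrix_vector)
qed

lemma saddle_point_minimizer_snd:
  assumes "saddle_point (lagrangian f g F G h) xs ys ls"
  shows "g ys + (transpose G *v ls) \<bullet> ys \<le> g y + (transpose G *v ls) \<bullet> y"
proof -
  have "lagrangian f g F G h xs ys ls \<le> lagrangian f g F G h xs y ls"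
    using assms by (auto simp: saddle_point_def)
  then show ?thesis
    by (simp add: lagrangian_def inner_transpose_mult inner_add_right inner_diff_right
        del: transpose_matrix_vector)
qed

section \<open>Decay of the energy\<close>

theorem theorem3p3:
  fixes f :: "real^'d1 \<Rightarrow> real" and g :: "real^'d2 \<Rightarrow> real"
    and F :: "real^'d1^'m" and G :: "real^'d2^'m" and h :: "real^'m" and s :: real
    and xs :: "real^'d1" and ys :: "real^'d2" and ls :: "real^'m"
    and X :: "real \<Rightarrow> real^'d1" and Y :: "real \<Rightarrow> real^'d2" and \<Lambda> :: "real \<Rightarrow> real^'m"
  assumes "f \<in> diff_convex \<inter> prox_solvable F s"
    and "g \<in> diff_convex"
    and "s > 0"
    and "saddle_point (lagrangian f g F G h) xs ys ls"
    and "ode_solution f g F G h s X Y \<Lambda>"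
  shows "antimono_on {0..}
    (\<lambda>t. 1 / (2 * s) * (norm (G *v (Y t - ys)))\<^sup>2 + s / 2 * (norm (\<Lambda> t - ls))\<^sup>2)"
proof (rule antimono_on_half_line)
  have f: "convex_on UNIV f" "\<And>x. f differentiable at x"
    and g: "convex_on UNIV g" "\<And>y. g differentiable at y"
    using assms(1,2) by (auto simp: diff_convex_def differentiable_on_def)
  have C1: "C1_curve Y" "C1_curve \<Lambda>"
    and eqX: "(transpose F ** G) *v time_deriv Y t = transpose F *v \<Lambda> t + gradient f (X t)"
    and eqY: "gradient g (Y t) = - (transpose G *v \<Lambda> t)"
    and eqL: "s\<^sup>2 *\<^sub>R time_deriv \<Lambda> t = F *v X t + G *v Y t - h" if "t \<ge> 0" for t
    using assms(5) that
    by (auto simp: ode_solution_def eq_neg_iff_add_eq_0 add.commute simp del: transpose_matrix_vector)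
  note [continuous_intros] = C1_curve_continuous_on[OF C1(1)] C1_curve_continuous_on[OF C1(2)]
    bounded_linear.continuous_on[OF matrix_vector_mul_bounded_linear]
  show "continuous_on {0..}
    (\<lambda>t. 1 / (2 * s) * (norm (G *v (Y t - ys)))\<^sup>2 + s / 2 * (norm (\<Lambda> t - ls))\<^sup>2)"
    by (intro continuous_intros) auto
  fix t :: real
  assume "t > 0"
  define Y' where "Y' = time_deriv Y t"
  define L' where "L' = time_deriv \<Lambda> t"
  have dY: "(Y has_vector_derivative Y') (at t)" and dL: "(\<Lambda> has_vector_derivative L') (at t)"
    unfolding Y'_def L'_def using C1 \<open>t > 0\<close> by (auto intro: C1_curve_has_vector_derivative)
  have dG: "((\<lambda>r. G *v (Y r - y)) has_vector_derivative G *v Y') (at t)" for y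
    using bounded_linear.has_vector_derivative[OF matrix_vector_mul_bounded_linear
        has_vector_derivative_diff[OF dY has_vector_derivative_const]] by simp
  have dLs: "((\<lambda>r. \<Lambda> r - ls) has_vector_derivative L') (at t)"
    using has_vector_derivative_diff[OF dL has_vector_derivative_const] by simp

  have obtuse: "L' \<bullet> (G *v Y') \<le> 0"
  proof (rule inner_derivatives_nonpos[OF dL dG[of 0]])
    have "\<forall>\<^sub>F r in at t. r > 0"
      using \<open>t > 0\<close> by (rule order_tendstoD[OF tendsto_ident_at])
    then show "\<forall>\<^sub>F r in at t. (\<Lambda> r - \<Lambda> t) \<bullet> (G *v (Y r - 0) - G *v (Y t - 0)) \<le> 0"
    proof eventually_elim
      case (elim r)
      have "transpose G *v (\<Lambda> r - \<Lambda> t) = - (gradient g (Y r) - gradient g (Y t))"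
        using eqY[of r] eqY[of t] elim \<open>t > 0\<close>
        by (simp add: matrix_vector_mult_diff_distrib del: transpose_matrix_vector)
      then have "(\<Lambda> r - \<Lambda> t) \<bullet> (G *v (Y r - Y t))
          = - ((gradient g (Y r) - gradient g (Y t)) \<bullet> (Y r - Y t))"
        by (metis inner_transpose_mult inner_minus_left)
      then show ?case
        using convex_gradient_monotone[OF g(1) g(2)[of "Y t"] g(2)[of "Y r"]]
        by (simp add: matrix_vector_mult_diff_distrib)
    qed
  qed

  \<comment> \<open>By the first two equations of the system, the next two inner products are the convexity terms
    \<open>\<langle>\<nabla>f(X) + F\<^sup>T\<lambda>\<^sup>*, X - x\<^sup>*\<rangle>\<close> and \<open>-\<langle>\<nabla>g(Y) + G\<^sup>T\<lambda>\<^sup>*, Y - y\<^sup>*\<rangle>\<close>.\<close>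
  have f_term: "(G *v Y' - (\<Lambda> t - ls)) \<bullet> (F *v (X t - xs)) \<ge> 0"
  proof -
    have "gradient f (X t) + transpose F *v ls = transpose F *v (G *v Y' - (\<Lambda> t - ls))"
      using eqX[of t] \<open>t > 0\<close>
      by (simp add: Y'_def matrix_vector_mul_assoc[symmetric] matrix_vector_mult_diff_distrib
          del: transpose_matrix_vector)
    then show ?thesis
      using gradient_inner_nonneg_of_minimizer[OF f(1) f(2)
          saddle_point_minimizer_fst[OF assms(4)], of "X t"]
      by (simp only: inner_transpose_mult)
  qed
  have g_term: "(\<Lambda> t - ls) \<bullet> (G *v (Y t - ys)) \<le> 0"
  proof -
    have "gradient g (Y t) + transpose G *v ls = transpose G *v (ls - \<Lambda> t)"
      using eqY[of t] \<open>t > 0\<close>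
      by (simp add: matrix_vector_mult_diff_distrib del: transpose_matrix_vector)
    then have "0 \<le> (ls - \<Lambda> t) \<bullet> (G *v (Y t - ys))"
      using gradient_inner_nonneg_of_minimizer[OF g(1) g(2)
          saddle_point_minimizer_snd[OF assms(4)], of "Y t"]
      by (simp only: inner_transpose_mult)
    then show ?thesis by (simp add: inner_diff_left)
  qed

  have L'_eq: "s\<^sup>2 *\<^sub>R L' = F *v (X t - xs) + G *v (Y t - ys)"
    using eqL[of t] \<open>t > 0\<close> saddle_point_feasible[OF assms(4)]
    by (simp add: L'_def matrix_vector_mult_diff_distrib algebra_simps)
  \<comment> \<open>\<open>D\<close> is the derivative of the energy; scaling by \<open>s\<close> makes \<open>s\<^sup>2 \<Lambda>'\<close> appear.\<close>
  define D where "D = 1 / s * ((G *v (Y t - ys)) \<bullet> (G *v Y')) + s * ((\<Lambda> t - ls) \<bullet> L')"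
  have "s * D = (G *v (Y t - ys)) \<bullet> (G *v Y') + (\<Lambda> t - ls) \<bullet> (s\<^sup>2 *\<^sub>R L')"
    using \<open>s > 0\<close> by (simp add: D_def field_simps power2_eq_square)
  also have "\<dots> = (s\<^sup>2 *\<^sub>R L') \<bullet> (G *v Y')
      - (G *v Y' - (\<Lambda> t - ls)) \<bullet> (F *v (X t - xs)) + (\<Lambda> t - ls) \<bullet> (G *v (Y t - ys))"
    unfolding L'_eq by (simp add: inner_add_left inner_add_right inner_diff_left inner_diff_right inner_commute)
  also have "\<dots> \<le> 0"
  proof -
    have "(s\<^sup>2 *\<^sub>R L') \<bullet> (G *v Y') \<le> 0"
      using obtuse by (simp add: mult_nonneg_nonpos)
    then show ?thesis using f_term g_term by linarith
  qed
  finally have "D \<le> 0"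
    using \<open>s > 0\<close> by (simp add: mult_le_0_iff)
  moreover have "DERIV (\<lambda>t. 1 / (2 * s) * (norm (G *v (Y t - ys)))\<^sup>2
      + s / 2 * (norm (\<Lambda> t - ls))\<^sup>2) t :> D"
    using DERIV_add[OF DERIV_cmult[OF has_real_derivative_norm_square[OF dG[of ys]], of "1 / (2 * s)"]
        DERIV_cmult[OF has_real_derivative_norm_square[OF dLs], of "s / 2"]]
    by (simp add: D_def)
  ultimately show "\<exists>D. DERIV (\<lambda>t. 1 / (2 * s) * (norm (G *v (Y t - ys)))\<^sup>2
      + s / 2 * (norm (\<Lambda> t - ls))\<^sup>2) t :> D \<and> D \<le> 0"
    by blast
qed

end
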